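(* Let $\zeta \in \mathbb{C}\setminus [-1,1]$ be such that $\delta_\zeta:=\inf_{x\in[-1,1]}|\zeta-x|>1$, and let $\{P_n\}$ be the polar Legendre polynomials with pole $\zeta$. Then all accumulation points of zeros of $\{P_n\}$ lie on the ellipse $$\Lambda(\zeta):= \left\{ z \in \mathbb{C}: z= \frac{\rho^2(\zeta)+1}{2\rho(\zeta)} \cos \theta + i \,\frac{\rho^2(\zeta)-1}{2\rho(\zeta)} \sin \theta , \quad 0 \leq \theta < 2 \pi \right\},$$ where $\rho(\zeta):=|\zeta+\sqrt{\zeta^2-1}|$ and the branch of the square root is chosen so that $|z+\sqrt{z^2-1}|>1$ for $z \in \mathbb{C} \setminus [-1,1]$.
   Context: For $n=0,1,2,\dots$, $L_n$ denotes the monic Legendre polynomial of degree $n$, i.e. the monic polynomial of degree $n$ with $\int_{-1}^1 L_n(x)x^k\,dx=0$ for $k=0,\dots,n-1$. For a fixed $\zeta\in\mathbb{C}$ (the pole), the $n$-th polar Legendre polynomial $P_n=P_{\zeta,n}$ is the monic polynomial of degree $n$ determined by $(n+1)L_n(z)=\left((z-\zeta)P_n(z)\right)'$, equivalently $(z-\zeta)P_n(z)=(n+1)\int_\zeta^z L_n(t)\,dt$. A point $w\in\mathbb{C}$ is an accumulation point of zeros of $\{P_n\}$ if every neighborhood of $w$ contains a zero of $P_n$ for infinitely many $n$. *)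

theory Defs
  imports "HOL-Analysis.Analysis" "HOL-Computational_Algebra.Polynomial"
begin

section \<open>Monic Legendre polynomials\<close>

definition is_monic_legendre :: "nat \<Rightarrow> real poly \<Rightarrow> bool" where
  "is_monic_legendre n p \<longleftrightarrow>
     degree p = n \<and> lead_coeff p = 1 \<and>
     (\<forall>k<n. integral {-1..1} (\<lambda>x. poly p x * x ^ k) = 0)"

definition legendre_monic :: "nat \<Rightarrow> real poly" where
  "legendre_monic n = (THE p. is_monic_legendre n p)"

definition legendre_inner :: "real poly \<Rightarrow> real poly \<Rightarrow> real" where
  "legendre_inner p q = integral {-1..1} (\<lambda>x. poly p x * poly q x)"

lemma poly_integrable: "(\<lambda>x. poly p x * poly q x) integrable_on {-1..1::real}"
  by (intro integrable_continuous_real continuous_intros)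

lemma legendre_inner_commute: "legendre_inner p q = legendre_inner q p"
  by (simp add: legendre_inner_def mult.commute)

lemma legendre_inner_add: "legendre_inner p (q + r) = legendre_inner p q + legendre_inner p r"
  unfolding legendre_inner_def
  by (simp add: distrib_left integral_add poly_integrable)

lemma legendre_inner_diff: "legendre_inner p (q - r) = legendre_inner p q - legendre_inner p r"
  unfolding legendre_inner_def
  by (simp add: right_diff_distrib integral_diff poly_integrable)

lemma legendre_inner_smult: "legendre_inner p (smult c q) = c * legendre_inner p q"
  unfolding legendre_inner_def by (simp add: mult.left_commute[of _ c])

lemma legendre_inner_0: "legendre_inner p 0 = 0"
  by (simp add: legendre_inner_def)

lemma legendre_inner_sum: "legendre_inner p (sum f A) = (\<Sum>k\<in>A. legendre_inner p (f k))"
  by (induction A rule: infinite_finite_induct)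
     (auto simp: legendre_inner_0 legendre_inner_add)

lemma legendre_inner_self_eq_0_iff: "legendre_inner p p = 0 \<longleftrightarrow> p = 0"
proof
  assume "legendre_inner p p = 0"
  then have "((\<lambda>x. poly p x * poly p x) has_integral 0) {-1..1}"
    using poly_integrable[of p p] by (simp add: legendre_inner_def has_integral_integral)
  then have *: "poly p x * poly p x = 0" if "x \<in> {-1..1}" for x
    using has_integral_0_cbox_imp_0[of "-1" 1 "\<lambda>x. poly p x * poly p x" x] that
    by (force intro!: continuous_intros)
  then have "{-1..1} \<subseteq> {x. poly p x = 0}" by auto
  moreover have "infinite {-1..1::real}" by simp
  ultimately show "p = 0" using poly_roots_finite finite_subset by blast
qed (simp add: legendre_inner_0)

lemma legendre_inner_lower_degree:
  assumes basis: "\<And>k. k < n \<Longrightarrow> degree (q k) = k \<and> lead_coeff (q k) = 1"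
    and orth: "\<And>k. k < n \<Longrightarrow> legendre_inner p (q k) = 0"
    and "r = 0 \<or> degree r < n"
  shows "legendre_inner p r = 0"
  using assms(3)
proof (induction "if r = 0 then 0 else Suc (degree r)" arbitrary: r rule: less_induct)
  case less
  show ?case
  proof (cases "r = 0")
    case False
    define k where "k = degree r"
    define s where "s = r - smult (lead_coeff r) (q k)"
    have k: "k < n" using less.prems False k_def by simp
    have deg: "degree s \<le> k" unfolding s_def
      by (rule degree_diff_le) (use basis[OF k] k_def in auto)
    have c: "coeff s k = 0" using basis[OF k] by (auto simp: s_def k_def[symmetric])
    have s: "s = 0 \<or> degree s < k"
      using deg c by (metis le_neq_implies_less leading_coeff_0_iff)
    then have "legendre_inner p s = 0"
      using less.hyps[of s] False k k_def by auto
    then show ?thesis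
      using orth[OF k] by (simp add: s_def legendre_inner_diff legendre_inner_smult)
  qed (simp add: legendre_inner_0)
qed

lemma is_monic_legendre_altdef:
  "is_monic_legendre n p \<longleftrightarrow>
     degree p = n \<and> lead_coeff p = 1 \<and> (\<forall>r. r = 0 \<or> degree r < n \<longrightarrow> legendre_inner p r = 0)"
proof -
  have m: "integral {-1..1} (\<lambda>x. poly p x * x ^ k) = legendre_inner p (monom 1 k)" for k
    by (simp add: legendre_inner_def poly_monom)
  show ?thesis
    unfolding is_monic_legendre_def m
    using legendre_inner_lower_degree[of n "monom 1" p]
    by (auto simp: degree_monom_eq)
qed

lemma ex_monic_legendre: "\<exists>p. is_monic_legendre n p"
proof (induction n rule: less_induct)
  case (less n)
  then obtain q where q: "\<And>k. k < n \<Longrightarrow> is_monic_legendre k (q k)" by metis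
  define c where "c k = legendre_inner (monom 1 n) (q k) / legendre_inner (q k) (q k)" for k
  define s where "s = (\<Sum>k<n. smult (c k) (q k))"
  define p where "p = monom 1 n - s"
  have qk: "degree (q k) = k \<and> lead_coeff (q k) = 1" if "k < n" for k
    using q[OF that] unfolding is_monic_legendre_def by blast
  have s: "coeff s i = 0" if "i \<ge> n" for i
    unfolding s_def coeff_sum using that qk by (auto intro!: sum.neutral coeff_eq_0)
  have dle: "degree p \<le> n" unfolding p_def by (rule degree_le) (use s in auto)
  have lc: "coeff p n = 1" using s[of n] by (simp add: p_def)
  have deg: "degree p = n" using dle lc by (simp add: le_antisym le_degree)
  have orth: "legendre_inner p (q j) = 0" if j: "j < n" for j
  proof -
    have qq: "legendre_inner (q j) (q k) = 0" if "k < n" "k \<noteq> j" for k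
    proof (cases "k < j")
      case True
      then show ?thesis using q[OF j] qk[OF that(1)] by (auto simp: is_monic_legendre_altdef)
    next
      case False
      then have "legendre_inner (q k) (q j) = 0"
        using q[OF that(1)] qk[OF j] that by (auto simp: is_monic_legendre_altdef)
      then show ?thesis by (simp add: legendre_inner_commute)
    qed
    have "q j \<noteq> 0" using qk[OF j] by auto
    then have nz: "legendre_inner (q j) (q j) \<noteq> 0" by (simp add: legendre_inner_self_eq_0_iff)
    have "legendre_inner (q j) s = (\<Sum>k<n. if k = j then c j * legendre_inner (q j) (q j) else 0)"
      unfolding s_def legendre_inner_sum legendre_inner_smult
      by (intro sum.cong) (auto simp: qq)
    also have "\<dots> = legendre_inner (q j) (monom 1 n)"
      using nz j by (simp add: c_def legendre_inner_commute)
    finally show ?thesis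
      by (simp add: p_def legendre_inner_commute[of _ "q j"] legendre_inner_diff)
  qed
  have "is_monic_legendre n p"
    unfolding is_monic_legendre_altdef
    using deg lc legendre_inner_lower_degree[of n q p, OF qk orth] by blast
  then show ?case by blast
qed

lemma monic_legendre_unique:
  assumes "is_monic_legendre n p" "is_monic_legendre n q"
  shows "p = q"
proof -
  let ?r = "p - q"
  have "degree ?r \<le> n" "coeff ?r n = 0"
    using assms by (auto simp: is_monic_legendre_def intro!: degree_diff_le)
  then have r: "?r = 0 \<or> degree ?r < n"
    by (metis le_neq_implies_less leading_coeff_0_iff)
  then have "legendre_inner ?r p = 0" "legendre_inner ?r q = 0"
    using assms by (auto simp: is_monic_legendre_altdef legendre_inner_commute[of ?r])
  then have "legendre_inner ?r ?r = 0" by (simp add: legendre_inner_diff)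
  then show ?thesis by (simp add: legendre_inner_self_eq_0_iff)
qed

lemma legendre_monic: "is_monic_legendre n (legendre_monic n)"
  unfolding legendre_monic_def
  by (rule theI') (use ex_monic_legendre monic_legendre_unique in blast)


section \<open>Polar Legendre polynomials\<close>

definition is_polar_legendre :: "complex \<Rightarrow> nat \<Rightarrow> complex poly \<Rightarrow> bool" where
  "is_polar_legendre \<zeta> n p \<longleftrightarrow>
     degree p = n \<and> lead_coeff p = 1 \<and>
     smult (of_nat (n + 1)) (map_poly complex_of_real (legendre_monic n)) =
       pderiv ([:-\<zeta>, 1:] * p)"

definition polar_legendre :: "complex \<Rightarrow> nat \<Rightarrow> complex poly" where
  "polar_legendre \<zeta> n = (THE p. is_polar_legendre \<zeta> n p)"

lemma pderiv_sum: "pderiv (sum f A) = (\<Sum>i\<in>A. pderiv (f i))"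
  by (induction A rule: infinite_finite_induct) (auto simp: pderiv_add)

lemma ex_antiderivative: "\<exists>q. pderiv q = p" for p :: "complex poly"
proof -
  let ?q = "\<Sum>i\<le>degree p. monom (coeff p i / of_nat (Suc i)) (Suc i)"
  have "pderiv (monom (coeff p i / of_nat (Suc i)) (Suc i)) = monom (coeff p i) i" for i
    by (simp add: pderiv_monom del: of_nat_Suc)
  then have "pderiv ?q = p"
    by (simp add: pderiv_sum poly_as_sum_of_monoms del: of_nat_Suc)
  then show ?thesis by blast
qed

lemma ex_polar_legendre: "\<exists>p. is_polar_legendre \<zeta> n p"
proof -
  let ?L = "map_poly complex_of_real (legendre_monic n)"
  have L: "degree ?L = n" "coeff ?L n = 1"
    using legendre_monic[of n] by (auto simp: is_monic_legendre_def coeff_map_poly degree_map_poly)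
  obtain q where q: "pderiv q = smult (of_nat (n + 1)) ?L" using ex_antiderivative by blast
  have "poly (q - [:poly q \<zeta>:]) \<zeta> = 0" by simp
  then obtain p where p: "q - [:poly q \<zeta>:] = [:-\<zeta>, 1:] * p"
    by (metis dvd_def poly_eq_0_iff_dvd)
  have "pderiv (q - [:poly q \<zeta>:]) = pderiv q" by (simp add: pderiv_diff)
  then have d: "pderiv ([:-\<zeta>, 1:] * p) = smult (of_nat (n + 1)) ?L"
    using p q by metis
  have "smult (of_nat (n + 1)) ?L \<noteq> 0"
    using L(2) by (auto simp del: of_nat_Suc of_nat_add)
  then have "p \<noteq> 0" using d by auto
  then have dp: "degree ([:-\<zeta>, 1:] * p) = Suc (degree p)" by (subst degree_mult_eq) auto
  have "degree (pderiv ([:-\<zeta>, 1:] * p)) = n"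
    unfolding d using L by (simp del: of_nat_Suc)
  then have deg: "degree p = n" unfolding degree_pderiv dp by simp
  have "of_nat (Suc n) * coeff ([:-\<zeta>, 1:] * p) (Suc n) = of_nat (n + 1) * coeff ?L n"
    using arg_cong[OF d, of "\<lambda>r. coeff r n"] by (simp add: coeff_pderiv del: of_nat_Suc mult_pCons_left)
  then have "coeff ([:-\<zeta>, 1:] * p) (Suc n) = 1"
    unfolding L by (simp del: of_nat_Suc mult_pCons_left)
  moreover have "lead_coeff ([:-\<zeta>, 1:] * p) = lead_coeff p"
    by (simp only: lead_coeff_mult) simp
  ultimately have "lead_coeff p = 1" using deg dp by metis
  then show ?thesis using d deg unfolding is_polar_legendre_def by metis
qed

lemma polar_legendre_unique:
  assumes "is_polar_legendre \<zeta> n p" "is_polar_legendre \<zeta> n q"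
  shows "p = q"
proof (rule ccontr)
  assume "p \<noteq> q"
  then have "degree ([:-\<zeta>, 1:] * (p - q)) = Suc (degree (p - q))"
    by (subst degree_mult_eq) auto
  moreover have "pderiv ([:-\<zeta>, 1:] * (p - q)) = 0"
    using assms unfolding is_polar_legendre_def right_diff_distrib pderiv_diff by simp
  ultimately show False by (simp only: pderiv_eq_0_iff)
qed

lemma polar_legendre: "is_polar_legendre \<zeta> n (polar_legendre \<zeta> n)"
  unfolding polar_legendre_def
  by (rule theI') (use ex_polar_legendre polar_legendre_unique in blast)


section \<open>Accumulation points of zeros\<close>

definition zeros_accumulate_at :: "(nat \<Rightarrow> complex poly) \<Rightarrow> complex \<Rightarrow> bool" where
  "zeros_accumulate_at P w \<longleftrightarrow>
     (\<forall>U. open U \<and> w \<in> U \<longrightarrow> infinite {n. \<exists>z\<in>U. poly (P n) z = 0})"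


section \<open>The ellipse\<close>

text \<open>
  The branch of \<open>sqrt (z\<^sup>2 - 1)\<close> with \<open>\<bar>z + sqrt (z\<^sup>2 - 1)\<bar> > 1\<close>; it exists and is unique
  exactly for \<open>z\<close> outside \<open>[-1,1]\<close>, and differs from \<open>csqrt (z\<^sup>2 - 1)\<close> on, e.g., the left
  half-plane.
\<close>
definition sqrt_branch :: "complex \<Rightarrow> complex" where
  "sqrt_branch z = (THE w. w\<^sup>2 = z\<^sup>2 - 1 \<and> cmod (z + w) > 1)"

lemma sqrt_branch_ex1:
  assumes "z \<notin> complex_of_real ` {-1..1}"
  shows "\<exists>!w. w\<^sup>2 = z\<^sup>2 - 1 \<and> cmod (z + w) > 1"
proof -
  have inv: "cmod (z + w) * cmod (z - w) = 1" if "w\<^sup>2 = z\<^sup>2 - 1" for w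
  proof -
    have "(z + w) * (z - w) = 1" using that by (simp add: algebra_simps power2_eq_square)
    then show ?thesis by (metis norm_mult norm_one)
  qed
  have ne: "cmod (z + w) \<noteq> 1" if w: "w\<^sup>2 = z\<^sup>2 - 1" for w
  proof
    assume 1: "cmod (z + w) = 1"
    have "(z + w) * (z - w) = 1" using w by (simp add: algebra_simps power2_eq_square)
    moreover have "(z + w) * cnj (z + w) = 1" 
      using 1 by (metis complex_norm_square of_real_1 power_one)
    ultimately have "z - w = cnj (z + w)"
      by (metis mult_left_cancel mult_zero_left zero_neq_one)
    then have "2 * z = (z + w) + cnj (z + w)" by (simp only: flip: \<open>z - w = _\<close>) simp
    also have "\<dots> = complex_of_real (2 * Re (z + w))" by (rule complex_add_cnj)
    finally have "z = complex_of_real (Re (z + w))" by (simp add: complex_eq_iff)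
    moreover have "\<bar>Re (z + w)\<bar> \<le> 1" using abs_Re_le_cmod[of "z + w"] 1 by simp
    then have "Re (z + w) \<in> {-1..1}" by (simp add: abs_le_iff)
    ultimately show False using assms by blast
  qed
  define s where "s = csqrt (z\<^sup>2 - 1)"
  have s: "s\<^sup>2 = z\<^sup>2 - 1" "(-s)\<^sup>2 = z\<^sup>2 - 1" by (simp_all add: s_def)
  have "cmod (z + s) > 1 \<or> cmod (z - s) > 1"
    using inv[OF s(1)] ne[OF s(1)] ne[OF s(2)]
    by (smt (verit) mult_le_one norm_ge_zero mult_less_cancel_left2 add_uminus_conv_diff mult_cancel_left2)
  then obtain w where w: "w\<^sup>2 = z\<^sup>2 - 1" "cmod (z + w) > 1"
    using s by (metis add_uminus_conv_diff)
  moreover have "v = w" if v: "v\<^sup>2 = z\<^sup>2 - 1" "cmod (z + v) > 1" for v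
  proof (rule ccontr)
    assume "v \<noteq> w"
    then have "v = - w" using v(1) w(1) by (metis power2_eq_iff)
    then have "cmod (z - w) > 1" using v(2) by simp
    then have "1 * 1 < cmod (z + w) * cmod (z - w)"
      using w(2) by (intro mult_strict_mono) auto
    then show False using inv[OF w(1)] by simp
  qed
  ultimately show ?thesis by blast
qed

definition rho :: "complex \<Rightarrow> real" where
  "rho z = cmod (z + sqrt_branch z)"

definition ellipse :: "complex \<Rightarrow> complex set" where
  "ellipse \<zeta> =
     {z. \<exists>\<theta>::real. 0 \<le> \<theta> \<and> \<theta> < 2 * pi \<and>
        z = complex_of_real (((rho \<zeta>)\<^sup>2 + 1) / (2 * rho \<zeta>) * cos \<theta>)
          + \<i> * complex_of_real (((rho \<zeta>)\<^sup>2 - 1) / (2 * rho \<zeta>) * sin \<theta>)}"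

end

theory Submission
  imports Defs "HOL-Complex_Analysis.Complex_Analysis"
    "HOL-Computational_Algebra.Fundamental_Theorem_Algebra" "HOL-Real_Asymp.Real_Asymp"
begin

text \<open>
  For \<open>n \<ge> 1\<close> a zero \<open>z\<close> of \<open>P\<^sub>n\<close> satisfies \<open>V z = V \<zeta>\<close> for every primitive \<open>V\<close> of \<open>L\<^sub>n\<close>
  (\<open>zero_polar_legendre_imp\<close>). By Rodrigues' formula the derivative of order \<open>n - 1\<close> of
  \<open>(z\<^sup>2 - 1)\<^sup>n\<close> is such a primitive up to a factor. When scaled to be monic, its modulus at
  \<open>z = (u + 1/u) / 2\<close>, \<open>|u| \<ge> 1\<close>, behaves like \<open>(|u| / 2) ^ (n + 1)\<close> up to factors of
  subexponential growth, locally uniformly off \<open>[-1,1]\<close>, and near \<open>[-1,1]\<close> it has at most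
  this size. Hence zeros can accumulate only where \<open>|u|\<close> equals its value \<open>\<rho>(\<zeta>)\<close> at \<open>\<zeta>\<close>,
  that is, on the ellipse through \<open>\<zeta>\<close> with foci \<open>-1\<close> and \<open>1\<close>.

  Both halves of this growth estimate are elementary. The upper bound is Cauchy's inequality
  on the circle about \<open>z\<close> of radius \<open>|z\<^sup>2 - 1| ^ (1/2)\<close>
  (\<open>legendre_primitive_upper_bound\<close>). For the lower bound, the Gauss-Lucas theorem places all
  zeros of the primitive in \<open>[-1,1]\<close>, so after division by \<open>(u / 2) ^ (n + 1)\<close> the monic
  primitive becomes a function of \<open>v = 1/u\<close> without zeros in the open unit disc, with value
  \<open>1\<close> at \<open>0\<close> and, by the upper bound, at most of linear size in \<open>n\<close>. Such a function cannot
  be exponentially small in the interior. Harnack's inequality would give this; here it follows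
  from multiplying \<open>f v\<close> with \<open>f (- v)\<close> repeatedly (\<open>prod_linear_factors_lower_bound\<close>).

  The two bounds combine to \<open>legendre_primitive_separation\<close>, in which the smaller of the two
  ellipses is allowed to degenerate to \<open>[-1,1]\<close>. It is applied once with \<open>\<zeta>\<close> on the outer
  and once with \<open>\<zeta>\<close> on the inner side.
\<close>

section \<open>Rodrigues' formula and primitives of the Legendre polynomials\<close>

text \<open>
  Up to a constant factor this is the primitive of \<open>L\<^bsub>n+1\<^esub>\<close> that vanishes at \<open>-1\<close>
  (and hence at \<open>1\<close>); the constant is immaterial, since only equalities and inequalities
  between two values of one primitive are used. It is polymorphic because orthogonality is
  a statement over the reals and the location of zeros one over the complex numbers.
\<close>
definition legendre_primitive :: "nat \<Rightarrow> 'a::field_char_0 poly" where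
  "legendre_primitive n = (pderiv ^^ n) ([:-1, 0, 1:] ^ Suc n)"

lemma linear_power_dvd_pderiv:
  fixes p :: "'a::idom poly"
  assumes "[:-a, 1:] ^ Suc m dvd p"
  shows "[:-a, 1:] ^ m dvd pderiv p"
proof -
  obtain q where "p = [:-a, 1:] ^ Suc m * q" using assms by (elim dvdE)
  then have "pderiv p = [:-a, 1:] ^ m * ([:-a, 1:] * pderiv q + smult (of_nat (Suc m)) q)"
    by (simp only: pderiv_mult pderiv_power_Suc) (simp add: pderiv_pCons algebra_simps)
  then show ?thesis by simp
qed

lemma poly_higher_pderiv_endpoint:
  fixes a :: "'a::field_char_0"
  assumes "k < n" "a\<^sup>2 = 1"
  shows "poly ((pderiv ^^ k) ([:-1, 0, 1:] ^ n)) a = 0"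
proof -
  have "[:-a, 1:] ^ (n - k) dvd (pderiv ^^ k) ([:-1, 0, 1:] ^ n)" if "k \<le> n" for k
    using that
  proof (induction k)
    case 0
    have "[:-1, 0, 1:] = [:-a, 1:] * [:a, 1:]"
      using assms(2) by (simp add: power2_eq_square)
    then have "[:-a, 1:] dvd [:-1, 0, 1:]" by (metis dvd_triv_left)
    then show ?case by (simp add: dvd_power_same)
  next
    case (Suc k)
    then have "[:-a, 1:] ^ Suc (n - Suc k) dvd (pderiv ^^ k) ([:-1, 0, 1:] ^ n)"
      by (simp add: Suc_diff_Suc del: power_Suc)
    from linear_power_dvd_pderiv[OF this] show ?case by simp
  qed
  from this[of k] have "[:-a, 1:] dvd (pderiv ^^ k) ([:-1, 0, 1:] ^ n)"
    using assms(1) by (metis dvd_power dvd_trans less_imp_le zero_less_diff)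
  then show ?thesis by (simp add: poly_eq_0_iff_dvd)
qed

text \<open>
  Integration by parts; the zeros at both endpoints remove the boundary term.
\<close>
lemma legendre_inner_by_parts:
  assumes "poly p 1 = 0" "poly p (-1) = 0"
  shows "legendre_inner (pderiv p) q = - legendre_inner p (pderiv q)"
proof -
  have "((\<lambda>x. poly (pderiv (p * q)) x) has_integral poly (p * q) 1 - poly (p * q) (-1)) {-1..1::real}"
    by (intro fundamental_theorem_of_calculus)
       (auto simp flip: has_real_derivative_iff_has_vector_derivative
             intro: has_field_derivative_at_within[OF poly_DERIV] simp del: poly_mult)
  then have "integral {-1..1} (\<lambda>x. poly (pderiv (p * q)) x) = 0"
    using assms by (simp add: integral_unique)
  moreover have "integral {-1..1} (\<lambda>x. poly (pderiv (p * q)) x)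
      = legendre_inner p (pderiv q) + legendre_inner q (pderiv p)"
    unfolding legendre_inner_def pderiv_mult poly_add poly_mult
    by (intro integral_add poly_integrable)
  ultimately show ?thesis by (simp add: legendre_inner_commute)
qed

text \<open>
  Every integration by parts moves one derivative from \<open>(x\<^sup>2 - 1)\<^sup>n\<close> to \<open>q\<close>. The endpoint
  zeros of \<open>(x\<^sup>2 - 1)\<^sup>n\<close> have order \<open>n\<close>, so all boundary terms vanish, and \<open>k\<close> steps
  annihilate a polynomial of degree below \<open>k\<close>.
\<close>
lemma legendre_inner_higher_pderiv:
  assumes "k \<le> n" "q = 0 \<or> degree q < k"
  shows "legendre_inner ((pderiv ^^ k) ([:-1, 0, 1:] ^ n)) q = 0"
  using assms
proof (induction k arbitrary: q)
  case 0
  then show ?case by (simp add: legendre_inner_0)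
next
  case (Suc k)
  have "pderiv q = 0 \<or> degree (pderiv q) < k"
    using Suc.prems(2) by (auto simp: degree_pderiv pderiv_eq_0_iff)
  then show ?case
    using Suc.IH[of "pderiv q"] Suc.prems(1)
    by (simp add: legendre_inner_by_parts poly_higher_pderiv_endpoint)
qed

lemma degree_square_minus_one_power: "degree ([:-1, 0, 1::'a::field_char_0:] ^ n) = 2 * n"
  by (simp add: degree_power_eq)

lemma degree_legendre_primitive: "degree (legendre_primitive n :: 'a::field_char_0 poly) = n + 2"
  by (simp add: legendre_primitive_def degree_higher_pderiv degree_square_minus_one_power
           del: power_Suc)

lemma lead_coeff_legendre_primitive:
  "lead_coeff (legendre_primitive n :: 'a::field_char_0 poly) = fact (2 * n + 2) / fact (n + 2)"
proof -
  let ?W = "[:-1, 0, 1::'a:] ^ Suc n"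
  have "lead_coeff ?W = 1" by (subst lead_coeff_power) simp
  then have "coeff ?W (n + 2 + n) = 1"
    unfolding degree_square_minus_one_power by (simp add: mult_2)
  moreover have "(fact (n + 2 + n) :: 'a) = fact (n + 2) * pochhammer (of_nat (Suc (n + 2))) n"
    using pochhammer_product'[of "1::'a" "n + 2" n] by (simp only: pochhammer_fact of_nat_Suc)
  moreover have "2 * n + 2 = n + 2 + n" by simp
  ultimately show ?thesis
    unfolding degree_legendre_primitive unfolding legendre_primitive_def coeff_higher_pderiv
    by (simp only: mult_1_right nonzero_mult_div_cancel_left fact_nonzero not_False_eq_True)
qed

lemma legendre_primitive_nonzero: "legendre_primitive n \<noteq> (0 :: 'a::field_char_0 poly)"
  using degree_legendre_primitive[of n, where 'a='a] by auto

text \<open>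
  Orthogonality to all polynomials of smaller degree determines a polynomial up to a factor.
\<close>
theorem Rodrigues:
  "\<exists>c\<noteq>0. pderiv (legendre_primitive n) = smult c (legendre_monic (Suc n))"
proof -
  let ?p = "pderiv (legendre_primitive n) :: real poly"
  let ?c = "lead_coeff ?p"
  have deg: "degree ?p = Suc n"
    by (simp add: degree_pderiv degree_legendre_primitive)
  then have c: "?c \<noteq> 0" by (metis degree_0 leading_coeff_0_iff nat.distinct(1))
  have "?p = (pderiv ^^ Suc n) ([:-1, 0, 1:] ^ Suc n)"
    by (simp add: legendre_primitive_def)
  then have orth: "legendre_inner ?p r = 0" if "r = 0 \<or> degree r < Suc n" for r
    using legendre_inner_higher_pderiv[OF order_refl that] by (simp only:)
  have "is_monic_legendre (Suc n) (smult (1 / ?c) ?p)"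
    unfolding is_monic_legendre_altdef
    using c deg orth
    by (auto simp: legendre_inner_commute[of "smult _ _"] legendre_inner_smult
                   legendre_inner_commute[of _ ?p])
  then have "smult (1 / ?c) ?p = legendre_monic (Suc n)"
    using monic_legendre_unique legendre_monic by blast
  then have "?p = smult ?c (legendre_monic (Suc n))" using c
    by (metis smult_smult smult_1_left divide_inverse mult_1 right_inverse)
  then show ?thesis using c by blast
qed

lemma map_poly_of_real_mult:
  "map_poly complex_of_real (p * q) = map_poly of_real p * map_poly of_real q"
  by (rule poly_eqI) (simp add: coeff_map_poly coeff_mult)

lemma map_poly_of_real_legendre_primitive:
  "map_poly complex_of_real (legendre_primitive n) = legendre_primitive n"
proof -
  have pow: "map_poly complex_of_real ([:-1, 0, 1:] ^ m) = [:-1, 0, 1:] ^ m" for m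
    by (induction m) (simp_all add: map_poly_of_real_mult map_poly_pCons del: mult_pCons_left)
  have po: "complex_of_real (pochhammer (of_nat a) b) = pochhammer (of_nat a) b" for a b
    by (induction b) (simp_all add: pochhammer_Suc)
  have "of_real (coeff ([:-1, 0, 1:] ^ Suc n) i) = coeff ([:-1, 0, 1:: complex:] ^ Suc n) i" for i
    unfolding pow[of "Suc n", symmetric] by (simp add: coeff_map_poly del: power_Suc)
  then show ?thesis
    by (intro poly_eqI)
       (simp add: legendre_primitive_def coeff_map_poly coeff_higher_pderiv po del: power_Suc of_nat_Suc)
qed

text \<open>
  Both \<open>(z - \<zeta>) P\<^bsub>n+1\<^esub>(z)\<close> and \<open>legendre_primitive n\<close> are primitives of multiples of
  \<open>L\<^bsub>n+1\<^esub>\<close>, so after scaling they differ by a constant. The former takes the value \<open>0\<close> at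
  \<open>\<zeta>\<close> and at every zero of \<open>P\<^bsub>n+1\<^esub>\<close>, so the latter takes equal values at these points.
\<close>
lemma zero_polar_legendre_imp:
  assumes "poly (polar_legendre \<zeta> (Suc n)) z = 0"
  shows "poly (legendre_primitive n) z = poly (legendre_primitive n) \<zeta>"
proof -
  let ?Q = "[:-\<zeta>, 1:] * polar_legendre \<zeta> (Suc n)"
  obtain c where c: "c \<noteq> 0" "pderiv (legendre_primitive n) = smult c (legendre_monic (Suc n))"
    using Rodrigues by blast
  have "pderiv (map_poly complex_of_real (legendre_primitive n))
      = map_poly of_real (pderiv (legendre_primitive n))"
    by (rule poly_eqI) (simp add: coeff_pderiv coeff_map_poly)
  then have "pderiv (legendre_primitive n)
      = smult (of_real c) (map_poly complex_of_real (legendre_monic (Suc n)))"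
    unfolding c(2) map_poly_of_real_legendre_primitive by (simp add: map_poly_smult)
  moreover have "pderiv ?Q = smult (of_nat (n + 2)) (map_poly complex_of_real (legendre_monic (Suc n)))"
    using polar_legendre[of \<zeta> "Suc n"] unfolding is_polar_legendre_def by simp
  ultimately have "pderiv (smult (of_nat (n + 2)) (legendre_primitive n) - smult (of_real c) ?Q) = 0"
    by (simp only: pderiv_diff pderiv_smult smult_smult) (simp add: mult.commute)
  then obtain d where
    d: "smult (of_nat (n + 2)) (legendre_primitive n) - smult (of_real c) ?Q = [:d:]"
    by (metis pderiv_eq_0_iff degree_eq_zeroE)
  have "of_nat (n + 2) * poly (legendre_primitive n) x - of_real c * poly ?Q x = d" for x
    using arg_cong[OF d, of "\<lambda>p. poly p x"] by (simp only: poly_diff poly_smult) simp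
  from this[of z] this[of \<zeta>]
  have "of_nat (n + 2) * poly (legendre_primitive n) z = of_nat (n + 2) * poly (legendre_primitive n) \<zeta>"
    using assms by simp
  then show ?thesis unfolding mult_cancel_left of_nat_eq_0_iff by simp
qed

section \<open>The Gauss-Lucas theorem\<close>

text \<open>
  The logarithmic derivative of \<open>q\<close> at \<open>z\<close> is the sum of the \<open>1 / (z - x)\<close>. If all zeros \<open>x\<close>
  lie strictly on one side of a line through \<open>z\<close>, every summand points into the same open
  half-plane, and hence so does the sum.
\<close>
lemma pderiv_linear_factors_half_plane:
  fixes a z :: complex
  assumes "A \<noteq> {#}" "\<And>x. x \<in># A \<Longrightarrow> inner a z < inner a x"
  defines "q \<equiv> (\<Prod>x\<in>#A. [:-x, 1:])"
  shows "poly q z \<noteq> 0 \<and> Re (a * (poly (pderiv q) z / poly q z)) < 0"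
  using assms(1,2) unfolding q_def
proof (induction A)
  case (add x A)
  let ?q = "\<Prod>x\<in>#A. [:-x, 1:]"
  have "inner a (z - x) < 0" using add.prems by (simp add: inner_diff_right)
  then have zx: "z \<noteq> x" and "Re (a * cnj (z - x)) < 0"
    by (auto simp: inner_complex_def algebra_simps)
  then have neg: "Re (a / (z - x)) < 0"
    by (simp add: complex_div_cnj[of a] Re_divide_of_real divide_neg_pos del: complex_cnj_diff of_real_power)
  show ?case
  proof (cases "A = {#}")
    case True
    then show ?thesis using neg zx by (simp add: pderiv_pCons)
  next
    case False
    then have IH: "poly ?q z \<noteq> 0" "Re (a * (poly (pderiv ?q) z / poly ?q z)) < 0"
      using add by auto
    have "a * (poly (pderiv ([:-x, 1:] * ?q)) z / poly ([:-x, 1:] * ?q) z)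
        = a / (z - x) + a * (poly (pderiv ?q) z / poly ?q z)"
      using IH(1) zx by (simp only: pderiv_mult) (simp add: pderiv_pCons field_simps)
    then show ?thesis using IH neg zx by (simp del: mult_pCons_left)
  qed
qed simp

text \<open>
  A critical point outside \<open>S\<close> would be separated from all zeros by a line, and then the
  logarithmic derivative could not vanish there.
\<close>
theorem Gauss_Lucas:
  fixes p :: "complex poly"
  assumes "convex S" "closed S" "{z. poly p z = 0} \<subseteq> S" "degree p > 0"
  shows "{z. poly (pderiv p) z = 0} \<subseteq> S"
proof (clarify, rule ccontr)
  fix z assume z: "poly (pderiv p) z = 0" "z \<notin> S"
  obtain a b where ab: "inner a z < b" "\<And>x. x \<in> S \<Longrightarrow> b < inner a x"
    using separating_hyperplane_closed_point[OF assms(1,2) z(2)] by blast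
  have "p \<noteq> 0" using assms(4) by auto
  from alg_closed_imp_factorization[OF this]
  obtain A where A: "size A = degree p" "p = smult (lead_coeff p) (\<Prod>x\<in>#A. [:-x, 1:])"
    by (elim exE conjE) (rule that)
  let ?q = "\<Prod>x\<in>#A. [:-x, 1:]"
  have eval: "poly p x = lead_coeff p * poly ?q x" for x
    using arg_cong[OF A(2), of "\<lambda>p. poly p x"] unfolding poly_smult .
  have "x \<in> S" if "x \<in># A" for x
    using assms(3) eval[of x] multi_member_split[OF that] by auto
  then have "Re (a * (poly (pderiv ?q) z / poly ?q z)) < 0"
    using pderiv_linear_factors_half_plane[of A a z] ab assms(4) A(1)
    by (metis less_trans size_empty less_irrefl)
  moreover have "lead_coeff p * poly (pderiv ?q) z = 0"
    using z(1) arg_cong[OF A(2), of "\<lambda>p. poly (pderiv p) z"] unfolding pderiv_smult poly_smult by simp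
  ultimately show False using \<open>p \<noteq> 0\<close> by simp
qed

lemma Gauss_Lucas_higher:
  fixes p :: "complex poly"
  assumes "convex S" "closed S" "{z. poly p z = 0} \<subseteq> S" "k < degree p"
  shows "{z. poly ((pderiv ^^ k) p) z = 0} \<subseteq> S"
  using assms(4)
proof (induction k)
  case (Suc k)
  then show ?case
    using Gauss_Lucas[OF assms(1,2), of "(pderiv ^^ k) p"] by (simp add: degree_higher_pderiv)
qed (use assms(3) in simp)

lemma roots_legendre_primitive:
  fixes z :: complex
  assumes "poly (legendre_primitive n) z = 0"
  shows "\<exists>x\<in>{-1..1}. z = of_real x"
proof -
  \<comment> \<open>The zeros of \<open>(z\<^sup>2 - 1)\<^bsup>n+1\<^esup>\<close> are the endpoints of the segment.\<close>
  have "{z. poly ([:-1, 0, 1:] ^ Suc n) z = 0} \<subseteq> closed_segment (-1) (1::complex)"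
    by (auto simp: poly_power algebra_simps power2_eq_square[symmetric] power2_eq_1_iff)
  then have "z \<in> closed_segment (-1) (1::complex)"
    using Gauss_Lucas_higher[of "closed_segment (-1) (1::complex)" "[:-1, 0, 1:] ^ Suc n" n] assms
    by (auto simp: degree_square_minus_one_power legendre_primitive_def simp del: power_Suc)
  then have "z \<in> closed_segment (of_real (-1)) (of_real 1)" by simp
  then show ?thesis
    unfolding closed_segment_of_real by (auto simp: closed_segment_eq_real_ivl)
qed

section \<open>A lower bound for products of linear factors\<close>

text \<open>
  A substitute for Harnack's inequality: an upper bound on the whole unit disc, for a product
  without zeros in it, gives a lower bound inside the disc that is only polynomially weaker.
  Put \<open>f v = (\<Prod>a. 1 - a v)\<close>. Then \<open>f v * f (- v)\<close> is the product for the squares \<open>a\<^sup>2\<close> at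
  \<open>v\<^sup>2\<close>, so squaring the bound \<open>M\<close> and replacing \<open>|v|\<close> by \<open>|v|\<^sup>2\<close> costs one division by \<open>M\<close>.
  After \<open>k\<close> such steps the trivial estimate \<open>|1 - a v| \<ge> 1 - |v|\<close> is applied at radius
  \<open>|v| ^ (2 ^ k)\<close>, which is as small as desired. What matters later is that \<open>M\<close>
  enters with an exponent independent of the number of factors.
\<close>
lemma prod_linear_factors_lower_bound:
  fixes A :: "complex multiset"
  assumes "\<And>a. a \<in># A \<Longrightarrow> norm a \<le> 1"
    and "\<And>v. norm v \<le> 1 \<Longrightarrow> norm (\<Prod>a\<in>#A. 1 - a * v) \<le> M"
    and "norm v < 1"
  shows "(1 - norm v ^ (2 ^ k)) ^ size A \<le> M ^ (2 ^ k - 1) * norm (\<Prod>a\<in>#A. 1 - a * v)"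
  using assms
proof (induction k arbitrary: A M v)
  case 0
  have "(1 - norm v) ^ size A \<le> norm (\<Prod>a\<in>#A. 1 - a * v)"
    using 0(1)
  proof (induction A)
    case (add a A)
    have "norm (a * v) \<le> norm v"
      using add.prems[of a] by (simp add: norm_mult mult_left_le_one_le)
    then have "1 - norm v \<le> norm (1 - a * v)"
      using norm_triangle_ineq2[of 1 "a * v"] by simp
    then show ?case
      using add 0(3) by (auto simp: norm_mult intro!: mult_mono)
  qed simp
  then show ?case by simp
next
  case (Suc k)
  let ?f = "\<lambda>v. \<Prod>a\<in>#A. 1 - a * v"
  let ?B = "image_mset (\<lambda>a. a\<^sup>2) A"
  have sq: "(\<Prod>b\<in>#?B. 1 - b * v\<^sup>2) = ?f v * ?f (- v)" for v
    by (induction A) (simp_all add: algebra_simps power2_eq_square)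
  have M: "0 \<le> M" using order_trans[OF norm_ge_zero Suc.prems(2)[of 0]] by simp
  have "norm (\<Prod>b\<in>#?B. 1 - b * v) \<le> M\<^sup>2" if "norm v \<le> 1" for v
  proof -
    \<comment> \<open>Every point of the unit disc is the square of a point of the unit disc.\<close>
    have "norm (csqrt v) \<le> 1" using that by (simp add: norm_csqrt)
    then have "norm (?f (csqrt v) * ?f (- csqrt v)) \<le> M * M"
      unfolding norm_mult using Suc.prems(2)[of "csqrt v"] Suc.prems(2)[of "- csqrt v"] M
      by (intro mult_mono) auto
    then show ?thesis using sq[of "csqrt v"] by (simp only: power2_csqrt power2_eq_square[of M])
  qed
  moreover have "norm b \<le> 1" if "b \<in># ?B" for b
    using that Suc.prems(1) by (auto simp: norm_power power_le_one)
  moreover have "norm (v\<^sup>2) < 1"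
    using Suc.prems(3) by (simp add: norm_power power_less_one_iff)
  ultimately have "(1 - norm (v\<^sup>2) ^ (2 ^ k)) ^ size ?B
      \<le> (M\<^sup>2) ^ (2 ^ k - 1) * norm (\<Prod>b\<in>#?B. 1 - b * v\<^sup>2)"
    by (intro Suc.IH)
  also have "\<dots> = (M\<^sup>2) ^ (2 ^ k - 1) * (norm (?f (- v)) * norm (?f v))"
    by (simp add: sq norm_mult)
  also have "\<dots> \<le> (M\<^sup>2) ^ (2 ^ k - 1) * (M * norm (?f v))"
    using Suc.prems(2)[of "- v"] Suc.prems(3) M
    by (intro mult_left_mono mult_right_mono) auto
  also have "\<dots> = M ^ (2 * (2 ^ k - 1) + 1) * norm (?f v)"
    by (simp add: power_mult)
  also have "2 * (2 ^ k - 1) + 1 = 2 ^ Suc k - (1::nat)"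
    unfolding power_Suc using one_le_power[of "2::nat" k] by linarith
  also have "norm (v\<^sup>2) ^ 2 ^ k = norm v ^ 2 ^ Suc k"
    unfolding norm_power power_mult[symmetric] by simp
  finally show ?case by simp
qed

section \<open>The Joukowski map and growth of the primitives\<close>

text \<open>
  It maps \<open>|u| > 1\<close> conformally onto the complement of \<open>[-1,1]\<close> and circles about \<open>0\<close> to
  ellipses with foci \<open>-1\<close> and \<open>1\<close>; in these coordinates \<open>|u|\<close> is the growth rate of interest.
\<close>
definition joukowski :: "complex \<Rightarrow> complex" where
  "joukowski u = (u + 1 / u) / 2"

lemma higher_deriv_poly:
  fixes p :: "complex poly"
  shows "(deriv ^^ k) (poly p) = poly ((pderiv ^^ k) p)"
  by (induction k) (auto intro!: ext DERIV_imp_deriv)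

text \<open>
  With \<open>z = joukowski u\<close> and \<open>s = (u - 1/u) / 2\<close> one has \<open>z\<^sup>2 - 1 = s\<^sup>2\<close>. A point
  \<open>t = z + s w\<close> with \<open>|w| = 1\<close> satisfies \<open>t\<^sup>2 - 1 = 2 s w (z + s Re w)\<close>, and \<open>z + s Re w\<close> is a
  convex combination of \<open>z + s = u\<close> and \<open>z - s = 1/u\<close>.
\<close>
lemma square_minus_one_bound:
  fixes u t :: complex
  assumes "1 \<le> norm u" "norm (joukowski u - t) = norm ((u - 1 / u) / 2)"
  shows "norm (t\<^sup>2 - 1) \<le> 2 * norm u * norm ((u - 1 / u) / 2)"
proof -
  define z s where "z = joukowski u" and "s = (u - 1 / u) / 2"
  have u: "u \<noteq> 0" using assms(1) by auto
  have zs: "z\<^sup>2 - 1 = s\<^sup>2"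
    using u by (simp add: z_def s_def joukowski_def field_simps power2_eq_square)
  show ?thesis
  proof (cases "s = 0")
    case True
    then have "t = z" using assms(2) by (simp add: z_def s_def)
    then show ?thesis using True zs by (simp add: s_def)
  next
    case False
    define w where "w = (t - z) / s"
    define c where "c = Re w"
    have t: "t = z + s * w" using False by (simp add: w_def)
    have "norm (t - z) = norm s"
      using assms(2) unfolding z_def s_def by (simp only: norm_minus_commute)
    then have w: "norm w = 1"
      using False by (simp add: w_def norm_divide)
    have "w\<^sup>2 + w * cnj w = w * (w + cnj w)"
      by (simp add: power2_eq_square distrib_left)
    moreover have "w * cnj w = 1"
      using w complex_norm_square[of w] by simp
    moreover have "w + cnj w = 2 * of_real c"
      by (simp add: complex_add_cnj c_def)
    ultimately have w2: "w\<^sup>2 + 1 = 2 * of_real c * w"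
      by (simp only: mult.commute)
    have "t\<^sup>2 - 1 = (z\<^sup>2 - 1) + 2 * z * s * w + s\<^sup>2 * w\<^sup>2"
      unfolding t by (simp add: power2_eq_square algebra_simps)
    also have "\<dots> = s\<^sup>2 * (w\<^sup>2 + 1) + 2 * z * s * w"
      unfolding zs by (simp add: algebra_simps)
    also have "\<dots> = 2 * s * w * (z + s * of_real c)"
      unfolding w2 by (simp add: power2_eq_square algebra_simps)
    also have "z + s * of_real c = u * of_real ((1 + c) / 2) + of_real ((1 - c) / 2) / u"
      using u by (simp add: z_def s_def joukowski_def field_simps)
    finally have eq: "norm (t\<^sup>2 - 1)
        = 2 * norm s * norm (u * of_real ((1 + c) / 2) + of_real ((1 - c) / 2) / u)"
      by (simp add: norm_mult w)
    have c: "-1 \<le> c" "c \<le> 1"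
      using abs_Re_le_cmod[of w] w by (auto simp: c_def abs_le_iff)
    have "norm (u * of_real ((1 + c) / 2) + of_real ((1 - c) / 2) / u)
        \<le> norm (u * of_real ((1 + c) / 2)) + norm (of_real ((1 - c) / 2) / u)"
      by (rule norm_triangle_ineq)
    also have "\<dots> = norm u * ((1 + c) / 2) + ((1 - c) / 2) / norm u"
      using c by (simp only: norm_mult norm_divide norm_of_real) simp
    also have "((1 - c) / 2) / norm u \<le> norm u * ((1 - c) / 2)"
    proof -
      have "((1 - c) / 2) / norm u \<le> ((1 - c) / 2) / 1"
        using c assms(1) by (intro divide_left_mono) auto
      also have "\<dots> \<le> norm u * ((1 - c) / 2)"
        using c mult_right_mono[OF assms(1), of "(1 - c) / 2"] by simp
      finally show ?thesis .
    qed
    finally have "norm (u * of_real ((1 + c) / 2) + of_real ((1 - c) / 2) / u) \<le> norm u"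
      by (simp add: algebra_simps add_divide_distrib diff_divide_distrib)
    then have "norm (t\<^sup>2 - 1) \<le> 2 * norm s * norm u"
      unfolding eq by (intro mult_left_mono) auto
    then show ?thesis
      unfolding s_def by (simp only: mult_ac)
  qed
qed

text \<open>
  This is Cauchy's inequality for the \<open>n\<close>-th derivative of \<open>(t\<^sup>2 - 1)\<^bsup>n+1\<^esup>\<close> on the circle about
  \<open>joukowski u\<close> of radius \<open>|u - 1/u| / 2\<close>. This radius makes the bound on the circle sharp
  enough to reach the true growth rate. The circle degenerates only at the endpoints
  \<open>\<plusminus>1\<close>, where the polynomial vanishes.
\<close>
lemma legendre_primitive_upper_bound:
  fixes u :: complex
  assumes "1 \<le> norm u"
  shows "norm (poly (legendre_primitive n) (joukowski u)) \<le> fact n * 2 ^ (n + 1) * norm u ^ (n + 2)"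
proof -
  define s where "s = (u - 1 / u) / 2"
  have u: "u \<noteq> 0" using assms by auto
  have s: "norm s \<le> norm u"
  proof -
    have "norm s \<le> (norm u + 1 / norm u) / 2"
      using norm_triangle_ineq4[of u "1 / u"] by (simp add: s_def norm_divide)
    also have "1 / norm u \<le> norm u"
      using assms by (meson divide_le_eq_1 order_trans zero_less_one less_le_trans)
    finally show ?thesis by simp
  qed
  show ?thesis
  proof (cases "s = 0")
    case True
    then have "(joukowski u)\<^sup>2 = 1"
      using u by (auto simp: s_def joukowski_def field_simps power2_eq_square)
    then show ?thesis
      unfolding legendre_primitive_def
      by (subst poly_higher_pderiv_endpoint) (use assms in auto)
  next
    case False
    let ?W = "[:-1, 0, 1:] ^ Suc n :: complex poly"
    have "norm (poly ?W t) \<le> (2 * norm u * norm s) ^ Suc n"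
      if "norm (joukowski u - t) = norm s" for t
    proof -
      have "poly ?W t = (t\<^sup>2 - 1) ^ Suc n"
        by (simp add: poly_power power2_eq_square algebra_simps)
      then show ?thesis
        using square_minus_one_bound[OF assms that[unfolded s_def]]
        by (simp only: norm_power) (intro power_mono, auto simp: s_def)
    qed
    then have "norm ((deriv ^^ n) (poly ?W) (joukowski u))
        \<le> fact n * (2 * norm u * norm s) ^ Suc n / norm s ^ n"
      using False by (intro Cauchy_inequality) (auto intro!: holomorphic_intros continuous_intros)
    also have "\<dots> = fact n * 2 ^ (n + 1) * norm u ^ (n + 1) * norm s"
      using False by (simp add: power_mult_distrib field_simps)
    also have "\<dots> \<le> fact n * 2 ^ (n + 1) * norm u ^ (n + 1) * norm u"
      using s by (intro mult_left_mono) auto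
    finally show ?thesis
      by (simp add: legendre_primitive_def higher_deriv_poly mult_ac del: power_Suc)
         (simp add: mult_ac)
  qed
qed

text \<open>
  A real zero \<open>x = cos \<phi>\<close> contributes
  \<open>joukowski u - x = (u / 2) (1 - e / u) (1 - cnj e / u)\<close> with \<open>e = exp (i \<phi>)\<close> on the unit circle.
\<close>
lemma prod_joukowski_minus_real:
  fixes u :: complex
  assumes "\<And>x. x \<in># B \<Longrightarrow> \<exists>y\<in>{-1..1}. x = of_real y" "u \<noteq> 0"
  defines "e \<equiv> \<lambda>x. Complex (Re x) (sqrt (1 - (Re x)\<^sup>2))"
  shows "(\<Prod>x\<in>#B. joukowski u - x)
       = (u / 2) ^ size B * (\<Prod>a\<in>#image_mset e B + image_mset (\<lambda>x. cnj (e x)) B. 1 - a * (1 / u))"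
  using assms(1)
proof (induction B)
  case (add x B)
  obtain y where y: "x = of_real y" "-1 \<le> y" "y \<le> 1" using add.prems[of x] by auto
  have "e x * cnj (e x) = 1"
    using y by (simp add: e_def complex_mult_cnj abs_square_le_1)
  moreover have "e x + cnj (e x) = 2 * x"
    using y by (simp add: e_def complex_add_cnj)
  moreover have "(u / 2) * ((1 - e x * (1 / u)) * (1 - cnj (e x) * (1 / u)))
      = (u - (e x + cnj (e x)) + (e x * cnj (e x)) / u) / 2"
    using assms(2) by (simp add: field_simps)
  ultimately have "joukowski u - x = (u / 2) * ((1 - e x * (1 / u)) * (1 - cnj (e x) * (1 / u)))"
    by (simp add: joukowski_def field_simps)
  then show ?case using add by (simp add: mult_ac)
qed simp

definition legendre_primitive_lead :: "nat \<Rightarrow> real" where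
  "legendre_primitive_lead n = fact (2 * n + 2) / fact (n + 2)"

lemma legendre_primitive_lead_pos: "legendre_primitive_lead n > 0"
  by (simp add: legendre_primitive_lead_def)

text \<open>
  In the coordinate \<open>1/u\<close> of the unit disc the primitive is, apart from an explicit power of
  \<open>u\<close>, a product of linear factors with zeros on the unit circle only. This is where
  all zeros being in \<open>[-1,1]\<close> matters.
\<close>
lemma legendre_primitive_joukowski:
  obtains A :: "complex multiset" where "size A = 2 * (n + 2)" "\<And>a. a \<in># A \<Longrightarrow> norm a = 1"
    "\<And>u. u \<noteq> 0 \<Longrightarrow> poly (legendre_primitive n) (joukowski u)
       = of_real (legendre_primitive_lead n) * (u / 2) ^ (n + 2) * (\<Prod>a\<in>#A. 1 - a * (1 / u))"
proof -
  let ?V = "legendre_primitive n :: complex poly"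
  from alg_closed_imp_factorization[OF legendre_primitive_nonzero[of n, where 'a=complex]]
  obtain B where B: "size B = degree ?V" "?V = smult (lead_coeff ?V) (\<Prod>x\<in>#B. [:-x, 1:])"
    by (elim exE conjE) (rule that)
  have eval: "poly ?V z = of_real (legendre_primitive_lead n) * (\<Prod>x\<in>#B. z - x)" for z
  proof -
    have "poly (\<Prod>x\<in>#B. [:-x, 1:]) z = (\<Prod>x\<in>#B. z - x)"
      by (induction B) (simp_all add: algebra_simps)
    then show ?thesis
      using arg_cong[OF B(2), of "\<lambda>p. poly p z"]
      by (simp only: poly_smult lead_coeff_legendre_primitive legendre_primitive_lead_def)
         simp
  qed
  have real: "\<exists>y\<in>{-1..1}. x = of_real y" if "x \<in># B" for x
    using multi_member_split[OF that] by (intro roots_legendre_primitive[of n]) (auto simp: eval)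
  let ?e = "\<lambda>x. Complex (Re x) (sqrt (1 - (Re x)\<^sup>2))"
  let ?A = "image_mset ?e B + image_mset (\<lambda>x. cnj (?e x)) B"
  show ?thesis
  proof
    show "size ?A = 2 * (n + 2)"
      using B(1) by (simp add: degree_legendre_primitive)
    show "norm a = 1" if a: "a \<in># ?A" for a
    proof -
      obtain x where "x \<in># B" "a = ?e x \<or> a = cnj (?e x)" 
        using a unfolding set_mset_union set_image_mset by blast
      then show ?thesis using real[of x] by (auto simp: cmod_def abs_square_le_1)
    qed
    show "poly ?V (joukowski u) = of_real (legendre_primitive_lead n) * (u / 2) ^ (n + 2)
        * (\<Prod>a\<in>#?A. 1 - a * (1 / u))" if "u \<noteq> 0" for u
      using prod_joukowski_minus_real[OF real that] B(1)
      by (simp only: eval degree_legendre_primitive mult.assoc)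
  qed
qed

text \<open>
  The left-hand side comes from the upper bound by Cauchy's inequality; that it exceeds the
  leading coefficient by a factor of order \<open>n\<close> only is the estimate
  \<open>4 ^ N \<le> 2 N (2 N choose N)\<close> with \<open>N = n + 1\<close>.
\<close>
lemma fact_central_bound: "fact n * 2 ^ (2 * n + 3) \<le> 8 * real (n + 1) * legendre_primitive_lead n"
proof -
  let ?N = "n + 1"
  have pos: "0 < fact ?N * (fact ?N :: real)" "0 < 2 * real ?N" by simp_all
  have "real (2 * ?N choose ?N) = fact (2 * ?N) / (fact ?N * fact (2 * ?N - ?N))"
    by (rule binomial_fact) simp
  also have "2 * ?N - ?N = ?N" by simp
  finally have "4 ^ ?N / (2 * real ?N) \<le> fact (2 * ?N) / (fact ?N * fact ?N)"
    using central_binomial_lower_bound[of ?N] by simp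
  then have "4 ^ ?N * (fact ?N * fact ?N) \<le> fact (2 * ?N) * (2 * real ?N)"
    by (simp only: pos pos_divide_le_eq pos_le_divide_eq times_divide_eq_left)
  then have "4 ^ ?N * (fact ?N * fact ?N) \<le> 2 * real ?N * fact (2 * ?N)"
    by (simp only: mult_ac)
  moreover have "fact n * fact (n + 2) \<le> 2 * (fact ?N * fact ?N :: real)"
  proof -
    have "fact n * fact (n + 2) * real ?N = real (n + 2) * (fact ?N * fact ?N)"
      by (simp add: algebra_simps)
    also have "\<dots> \<le> 2 * real ?N * (fact ?N * fact ?N)"
      by (intro mult_right_mono) auto
    finally have "fact n * fact (n + 2) * real ?N \<le> (2 * (fact ?N * fact ?N)) * real ?N"
      by (simp only: mult_ac)
    then show ?thesis by (rule mult_right_le_imp_le) simp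
  qed
  then have "4 ^ ?N * (fact n * fact (n + 2)) \<le> 4 ^ ?N * (2 * (fact ?N * fact ?N :: real))"
    by (intro mult_left_mono) auto
  ultimately have "2 * (4 ^ ?N * (fact n * fact (n + 2))) \<le> 8 * real ?N * fact (2 * ?N)"
    by linarith
  moreover have "2 ^ (2 * n + 3) = 2 * (4 ^ ?N :: real)"
    by (simp add: power_add power_mult)
  ultimately show ?thesis
    by (simp add: legendre_primitive_lead_def field_simps del: fact_Suc)
qed

text \<open>
  The upper bound, read in the unit disc, bounds the product of linear factors by
  \<open>8 (n + 1)\<close>, and this is the hypothesis needed for the lower bound on that product.
\<close>
lemma legendre_primitive_two_sided_bound:
  fixes u :: complex and n k :: nat
  assumes "1 \<le> norm u"
  defines "M \<equiv> 8 * real (n + 1)" and "c \<equiv> legendre_primitive_lead n * (norm u / 2) ^ (n + 2)"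
  shows "norm (poly (legendre_primitive n) (joukowski u)) \<le> M * c"
    and "norm u > 1 \<Longrightarrow> c * (1 - (1 / norm u) ^ (2 ^ k)) ^ (2 * (n + 2))
           \<le> M ^ (2 ^ k - 1) * norm (poly (legendre_primitive n) (joukowski u))"
proof -
  have up: "norm (poly (legendre_primitive n) (joukowski u))
      \<le> M * (legendre_primitive_lead n * (norm u / 2) ^ (n + 2))" if "1 \<le> norm u" for u
  proof -
    have "norm (poly (legendre_primitive n) (joukowski u)) \<le> fact n * 2 ^ (n + 1) * norm u ^ (n + 2)"
      by (rule legendre_primitive_upper_bound[OF that])
    also have "\<dots> = fact n * 2 ^ (2 * n + 3) * (norm u / 2) ^ (n + 2)"
    proof -
      have "2 * n + 3 = (n + 1) + (n + 2)" by simp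
      then have "(2::real) ^ (2 * n + 3) = 2 ^ (n + 1) * 2 ^ (n + 2)"
        by (simp only: power_add)
      then show ?thesis unfolding power_divide by (simp only:) simp
    qed
    also have "\<dots> \<le> M * legendre_primitive_lead n * (norm u / 2) ^ (n + 2)"
      unfolding M_def by (intro mult_right_mono fact_central_bound) auto
    finally show ?thesis by (simp only: mult.assoc)
  qed
  then show "norm (poly (legendre_primitive n) (joukowski u)) \<le> M * c"
    unfolding c_def using assms(1) .
  obtain A :: "complex multiset" where
    A: "size A = 2 * (n + 2)" "\<And>a. a \<in># A \<Longrightarrow> norm a = 1"
    and prod: "\<And>u. u \<noteq> 0 \<Longrightarrow> poly (legendre_primitive n) (joukowski u)
       = of_real (legendre_primitive_lead n) * (u / 2) ^ (n + 2) * (\<Prod>a\<in>#A. 1 - a * (1 / u))"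
    by (rule legendre_primitive_joukowski[of n]) (rule that)
  have nprod: "norm (poly (legendre_primitive n) (joukowski u))
      = (legendre_primitive_lead n * (norm u / 2) ^ (n + 2)) * norm (\<Prod>a\<in>#A. 1 - a * (1 / u))"
    if "u \<noteq> 0" for u
    using legendre_primitive_lead_pos[of n] by (simp add: prod[OF that] norm_mult norm_power norm_divide)
  \<comment> \<open>The point \<open>v \<noteq> 0\<close> of the disc corresponds to \<open>u = 1/v\<close>, where the upper bound applies.\<close>
  have M: "norm (\<Prod>a\<in>#A. 1 - a * v) \<le> M" if "norm v \<le> 1" for v
  proof (cases "v = 0")
    case False
    let ?c = "legendre_primitive_lead n * (norm (1 / v) / 2) ^ (n + 2)"
    have "1 \<le> norm (1 / v)" using False that by (simp add: norm_divide)
    from up[OF this] have "?c * norm (\<Prod>a\<in>#A. 1 - a * v) \<le> ?c * M"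
      using nprod[of "1 / v"] False by (simp add: mult_ac)
    moreover have "?c > 0" using False legendre_primitive_lead_pos[of n] by (simp add: norm_divide)
    ultimately show ?thesis by (rule mult_left_le_imp_le)
  qed (simp add: M_def)
  assume "norm u > 1"
  then have u: "u \<noteq> 0" "norm (1 / u) < 1" by (auto simp: norm_divide divide_less_eq)
  have "(1 - (1 / norm u) ^ (2 ^ k)) ^ (2 * (n + 2))
      \<le> M ^ (2 ^ k - 1) * norm (\<Prod>a\<in>#A. 1 - a * (1 / u))"
    using prod_linear_factors_lower_bound[of A M "1 / u" k] A M u by (simp add: norm_divide)
  then have "c * (1 - (1 / norm u) ^ (2 ^ k)) ^ (2 * (n + 2))
      \<le> c * (M ^ (2 ^ k - 1) * norm (\<Prod>a\<in>#A. 1 - a * (1 / u)))"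
    unfolding c_def using legendre_primitive_lead_pos[of n] by (intro mult_left_mono) auto
  then show "c * (1 - (1 / norm u) ^ (2 ^ k)) ^ (2 * (n + 2))
      \<le> M ^ (2 ^ k - 1) * norm (poly (legendre_primitive n) (joukowski u))"
    unfolding nprod[OF u(1)] c_def[symmetric] by (simp only: mult_ac)
qed

text \<open>
  For large \<open>n\<close> the values outside an ellipse exceed those inside a smaller confocal one,
  uniformly: the squaring parameter \<open>k\<close> is chosen once, so that the loss
  \<open>(1 - \<beta> ^ (- 2 ^ k))\<^sup>2\<close> in the growth rate is smaller than the gap between \<open>\<alpha>\<close> and \<open>\<beta>\<close>, and
  the powers of \<open>n\<close> with exponent \<open>2 ^ k\<close> lose against the geometric growth.
\<close>
lemma legendre_primitive_separation:
  fixes \<alpha> \<beta> :: real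
  assumes "1 \<le> \<alpha>" "\<alpha> < \<beta>"
  shows "\<forall>\<^sub>F n in sequentially. \<forall>u v. 1 \<le> norm u \<longrightarrow> norm u \<le> \<alpha> \<longrightarrow> \<beta> \<le> norm v \<longrightarrow>
           norm (poly (legendre_primitive n) (joukowski u)) < norm (poly (legendre_primitive n) (joukowski v))"
proof -
  have "(\<lambda>k. (1 / \<beta>) ^ (2 ^ k)) \<longlonglongrightarrow> 0"
    using LIMSEQ_subseq_LIMSEQ[OF LIMSEQ_realpow_zero[of "1 / \<beta>"], of "\<lambda>k. 2 ^ k"] assms
    by (simp add: strict_mono_def o_def)
  then have "(\<lambda>k. \<beta> * (1 - (1 / \<beta>) ^ (2 ^ k))\<^sup>2) \<longlonglongrightarrow> \<beta> * (1 - 0)\<^sup>2"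
    by (intro tendsto_intros)
  then have "\<forall>\<^sub>F k in sequentially. \<alpha> < \<beta> * (1 - (1 / \<beta>) ^ (2 ^ k))\<^sup>2"
    using assms(2) by (intro order_tendstoD(1)) auto
  then obtain k where k: "\<alpha> < \<beta> * (1 - (1 / \<beta>) ^ (2 ^ k))\<^sup>2"
    by (auto simp: eventually_sequentially)
  define \<gamma> where "\<gamma> = \<beta> * (1 - (1 / \<beta>) ^ (2 ^ k))\<^sup>2"
  define K where "K = (2::nat) ^ k"
  have \<gamma>: "\<alpha> < \<gamma>" "0 < \<gamma>" "K \<ge> 1" using k assms(1) by (auto simp: \<gamma>_def K_def)
  have "(\<lambda>n. (8 * real (n + 1)) ^ K * (\<alpha> / \<gamma>) ^ (n + 2)) \<longlonglongrightarrow> 0"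
  proof -
    define c where "c = \<alpha> / \<gamma>"
    have "0 < c" "c < 1" using \<gamma> assms by (auto simp: c_def)
    then have "(\<lambda>n. (8 * (real n + 1)) ^ K * c ^ (n + 2)) \<longlonglongrightarrow> 0"
      by real_asymp
    then show ?thesis by (simp add: c_def add.commute)
  qed
  then have "\<forall>\<^sub>F n in sequentially. (8 * real (n + 1)) ^ K * (\<alpha> / \<gamma>) ^ (n + 2) < 1"
    by (intro order_tendstoD(2)) auto
  then show ?thesis
  proof eventually_elim
    case (elim n)
    let ?g = "\<lambda>u. norm (poly (legendre_primitive n) (joukowski u))"
    let ?M = "8 * real (n + 1)" and ?L = "legendre_primitive_lead n"
    show ?case
    proof (intro allI impI, rule ccontr)
      fix u v :: complex
      assume u: "1 \<le> norm u" "norm u \<le> \<alpha>" and v: "\<beta> \<le> norm v" and "\<not> ?g u < ?g v"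
      then have vu: "?g v \<le> ?g u" by simp
      have L: "?L > 0" by (rule legendre_primitive_lead_pos)
      have v1: "1 < norm v" using v assms by simp
      have MK: "?M ^ K = ?M ^ (K - 1) * ?M"
        using \<gamma>(3) power_minus_mult[of K ?M] by linarith
      have "?g u \<le> ?M * (?L * (norm u / 2) ^ (n + 2))"
        by (rule legendre_primitive_two_sided_bound(1)[OF u(1)])
      also have "\<dots> \<le> ?M * (?L * (\<alpha> / 2) ^ (n + 2))"
        using u L by (intro mult_left_mono power_mono) auto
      finally have gu: "?g u \<le> ?M * (?L * (\<alpha> / 2) ^ (n + 2))" .
      have "\<gamma> \<le> norm v * (1 - (1 / norm v) ^ K)\<^sup>2"
        unfolding \<gamma>_def K_def[symmetric]
      proof (intro mult_mono power_mono diff_left_mono)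
        show "1 / norm v \<le> 1 / \<beta>" 
          using v v1 assms by (intro divide_left_mono mult_pos_pos) linarith+
        show "0 \<le> 1 - (1 / \<beta>) ^ K" using assms by (simp add: power_le_one)
      qed (use v in auto)
      then have "(\<gamma> / 2) ^ (n + 2) \<le> (norm v / 2 * (1 - (1 / norm v) ^ K)\<^sup>2) ^ (n + 2)"
        using \<gamma> by (intro power_mono) auto
      also have "\<dots> = (norm v / 2) ^ (n + 2) * (1 - (1 / norm v) ^ K) ^ (2 * (n + 2))"
        by (simp only: power_mult_distrib power_mult)
      finally have "?L * (\<gamma> / 2) ^ (n + 2)
          \<le> ?L * (norm v / 2) ^ (n + 2) * (1 - (1 / norm v) ^ K) ^ (2 * (n + 2))"
        using L by (simp only: mult.assoc mult_le_cancel_left_pos)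
      also have "\<dots> \<le> ?M ^ (K - 1) * ?g v"
        unfolding K_def using v1 by (intro legendre_primitive_two_sided_bound(2)) auto
      also have "\<dots> \<le> ?M ^ (K - 1) * (?M * (?L * (\<alpha> / 2) ^ (n + 2)))"
        using vu gu by (intro mult_left_mono) auto
      also have "\<dots> = ?L * (?M ^ K * (\<alpha> / 2) ^ (n + 2))"
        unfolding MK by (simp only: mult_ac)
      finally have "(\<gamma> / 2) ^ (n + 2) \<le> ?M ^ K * (\<alpha> / 2) ^ (n + 2)"
        by (rule mult_left_le_imp_le[OF _ L])
      moreover have "(\<alpha> / 2) ^ (n + 2) = (\<alpha> / \<gamma>) ^ (n + 2) * (\<gamma> / 2) ^ (n + 2)"
        using \<gamma>(2) by (simp flip: power_mult_distrib)
      ultimately have "1 * (\<gamma> / 2) ^ (n + 2) \<le> (?M ^ K * (\<alpha> / \<gamma>) ^ (n + 2)) * (\<gamma> / 2) ^ (n + 2)"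
        by (simp only: mult_1 mult.assoc)
      then have "1 \<le> ?M ^ K * (\<alpha> / \<gamma>) ^ (n + 2)"
        by (rule mult_right_le_imp_le) (use \<gamma>(2) in simp)
      then show False using elim by simp
    qed
  qed
qed

section \<open>Confocal ellipses\<close>

text \<open>
  The sum of the distances to the foci determines \<open>|u|\<close> and depends continuously on the
  point, so it yields open neighbourhoods without any continuity of an inverse of the
  Joukowski map, which would fail on \<open>[-1,1]\<close>.
\<close>
lemma norm_joukowski_foci:
  assumes "u \<noteq> 0"
  shows "norm (joukowski u + 1) + norm (joukowski u - 1) = norm u + 1 / norm u"
proof -
  have "joukowski u + 1 = (u + 1)\<^sup>2 / (2 * u)" "joukowski u - 1 = (u - 1)\<^sup>2 / (2 * u)"
    using assms by (simp_all add: joukowski_def field_simps power2_eq_square)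
  then have "norm (joukowski u + 1) + norm (joukowski u - 1)
      = ((norm (u + 1))\<^sup>2 + (norm (u - 1))\<^sup>2) / (2 * norm u)"
    by (simp add: norm_divide norm_mult norm_power add_divide_distrib)
  also have "(norm (u + 1))\<^sup>2 + (norm (u - 1))\<^sup>2 = 2 * ((norm u)\<^sup>2 + 1)"
    by (simp add: cmod_power2) (simp add: power2_eq_square algebra_simps)
  finally show ?thesis using assms by (simp add: field_simps power2_eq_square)
qed

lemma joukowski_eqI:
  assumes "(z + s) * (z - s) = 1"
  shows "joukowski (z + s) = z"
proof -
  have "z + s \<noteq> 0" using assms by auto
  then have "1 / (z + s) = z - s" using assms by (simp add: divide_eq_eq mult.commute)
  then show ?thesis by (simp add: joukowski_def)
qed

text \<open>
  The two preimages of a point have product \<open>1\<close>, so one of them has modulus at least \<open>1\<close>.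
\<close>
lemma joukowski_surj:
  obtains u where "1 \<le> norm u" "z = joukowski u"
proof -
  define s where "s = csqrt (z\<^sup>2 - 1)"
  have *: "(z + s) * (z - s) = 1"
    by (simp add: s_def algebra_simps flip: power2_eq_square)
  have J: "z = joukowski (z + s)" "z = joukowski (z - s)"
    using joukowski_eqI[OF *] joukowski_eqI[of z "- s"] * by (simp_all add: mult.commute)
  have "norm (z + s) * norm (z - s) = 1" using * by (metis norm_mult norm_one)
  then have "1 \<le> norm (z + s) \<or> 1 \<le> norm (z - s)"
  proof (rule contrapos_pp)
    assume "\<not> (1 \<le> norm (z + s) \<or> 1 \<le> norm (z - s))"
    then have "norm (z + s) * norm (z - s) < 1 * 1"
      by (intro mult_strict_mono') auto
    then show "norm (z + s) * norm (z - s) \<noteq> 1" by simp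
  qed
  then show thesis using J that by blast
qed

lemma add_inverse_less_iff:
  fixes x y :: real
  assumes "1 \<le> x" "1 \<le> y"
  shows "x + 1 / x < y + 1 / y \<longleftrightarrow> x < y"
proof -
  have mono: "a + 1 / a < b + 1 / b" if "1 \<le> a" "a < b" for a b :: real
  proof -
    have "1 * b \<le> a * b" using that by (intro mult_right_mono) auto
    then have "1 < a * b" using that by linarith
    then have "0 < (b - a) * (a * b - 1) / (a * b)" using that by (intro divide_pos_pos mult_pos_pos) auto
    also have "\<dots> = (b + 1 / b) - (a + 1 / a)" using that by (simp add: field_simps)
    finally show ?thesis by simp
  qed
  show ?thesis
    by (cases x y rule: linorder_cases) (use mono[of x y] mono[of y x] assms in auto)
qed

lemma joukowski_on_ellipse:
  assumes "norm u = rho \<zeta>" "1 \<le> norm u"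
  shows "joukowski u \<in> ellipse \<zeta>"
proof -
  let ?r = "rho \<zeta>"
  have r: "?r > 0" using assms by simp
  obtain \<theta> where \<theta>: "0 \<le> \<theta>" "\<theta> < 2 * pi" "u = of_real ?r * exp (\<i> * of_real \<theta>)"
    using Arg2pi_eq[of u] Arg2pi[of u] assms(1) by (intro that[of "Arg2pi u"]) auto
  have "joukowski u = complex_of_real ((?r\<^sup>2 + 1) / (2 * ?r) * cos \<theta>)
          + \<i> * complex_of_real ((?r\<^sup>2 - 1) / (2 * ?r) * sin \<theta>)"
  proof -
    have "1 / u = of_real (1 / ?r) * exp (- (\<i> * of_real \<theta>))"
      using r by (simp add: \<theta>(3) exp_minus field_simps)
    then have "joukowski u = (of_real ?r * exp (\<i> * of_real \<theta>)
        + of_real (1 / ?r) * exp (- (\<i> * of_real \<theta>))) / 2"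
      by (simp only: joukowski_def flip: \<theta>(3))
    also have "\<dots> = complex_of_real ((?r\<^sup>2 + 1) / (2 * ?r) * cos \<theta>)
          + \<i> * complex_of_real ((?r\<^sup>2 - 1) / (2 * ?r) * sin \<theta>)"
      using r by (simp add: complex_eq_iff Re_exp Im_exp field_simps power2_eq_square)
    finally show ?thesis .
  qed
  then show ?thesis
    unfolding ellipse_def by (intro CollectI exI[of _ \<theta>] conjI \<theta>(1,2))
qed

lemma rho_joukowski:
  assumes "\<zeta> \<notin> complex_of_real ` {-1..1}"
  obtains u where "norm u = rho \<zeta>" "1 < rho \<zeta>" "\<zeta> = joukowski u"
proof -
  have w: "(sqrt_branch \<zeta>)\<^sup>2 = \<zeta>\<^sup>2 - 1" "cmod (\<zeta> + sqrt_branch \<zeta>) > 1"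
    using theI'[OF sqrt_branch_ex1[OF assms]] by (auto simp: sqrt_branch_def)
  then have "(\<zeta> + sqrt_branch \<zeta>) * (\<zeta> - sqrt_branch \<zeta>) = 1"
    by (simp add: algebra_simps power2_eq_square)
  then have J: "\<zeta> = joukowski (\<zeta> + sqrt_branch \<zeta>)"
    by (rule joukowski_eqI[symmetric])
  show thesis
    by (rule that[OF _ _ J]) (use w(2) in \<open>simp_all add: rho_def\<close>)
qed

section \<open>Accumulation points of zeros\<close>
theorem theorem3:
  fixes \<zeta> :: complex
  assumes "\<zeta> \<notin> complex_of_real ` {-1..1}"
    and "(INF x\<in>{-1..1::real}. cmod (\<zeta> - complex_of_real x)) > 1"
  shows "\<forall>w. zeros_accumulate_at (polar_legendre \<zeta>) w \<longrightarrow> w \<in> ellipse \<zeta>"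
proof (intro allI impI)
  fix w assume acc: "zeros_accumulate_at (polar_legendre \<zeta>) w"
  obtain q where q: "norm q = rho \<zeta>" "1 < rho \<zeta>" "\<zeta> = joukowski q"
    by (rule rho_joukowski[OF assms(1)])
  obtain r where r: "1 \<le> norm r" "w = joukowski r" by (rule joukowski_surj)
  \<comment> \<open>The level sets of \<open>?f\<close> are the ellipses with foci \<open>-1\<close> and \<open>1\<close>.\<close>
  let ?f = "\<lambda>z::complex. norm (z + 1) + norm (z - 1)"
  \<comment> \<open>The index shift drops \<open>n = 0\<close>, for which \<open>legendre_primitive\<close> provides no primitive.\<close>
  have zero: "\<exists>n\<ge>N. \<exists>u. 1 \<le> norm u \<and> joukowski u \<in> U
      \<and> poly (legendre_primitive n) (joukowski u) = poly (legendre_primitive n) \<zeta>"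
    if "open U" "w \<in> U" for U N
  proof -
    have "infinite {n. \<exists>z\<in>U. poly (polar_legendre \<zeta> n) z = 0}"
      using acc that unfolding zeros_accumulate_at_def by blast
    then obtain n z where n: "Suc N \<le> n" "z \<in> U" "poly (polar_legendre \<zeta> n) z = 0"
      unfolding infinite_nat_iff_unbounded_le by blast
    obtain m where m: "n = Suc m" "N \<le> m" using n(1) by (cases n) auto
    obtain u where "1 \<le> norm u" "z = joukowski u" by (rule joukowski_surj)
    then show ?thesis using m n zero_polar_legendre_imp[of \<zeta> m z] by blast
  qed
  have f: "?f (joukowski u) = norm u + 1 / norm u" if "1 \<le> norm u" for u
    using norm_joukowski_foci[of u] that by fastforce
  have "norm r = rho \<zeta>"
  proof (rule ccontr)
    assume "norm r \<noteq> rho \<zeta>"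
    then consider "norm r < rho \<zeta>" | "rho \<zeta> < norm r" by linarith
    then show False
    proof cases
      case 1
      \<comment> \<open>Near \<open>w\<close> the primitives are eventually too small to take their value at \<open>\<zeta>\<close>.\<close>
      then obtain \<alpha> where \<alpha>: "norm r < \<alpha>" "\<alpha> < rho \<zeta>" using dense by blast
      have "open {z. ?f z < \<alpha> + 1 / \<alpha>}" by (intro open_Collect_less continuous_intros)
      moreover have "w \<in> {z. ?f z < \<alpha> + 1 / \<alpha>}"
        using \<alpha> r add_inverse_less_iff[of "norm r" \<alpha>] by (simp add: f)
      moreover obtain N where N: "\<And>n u v. N \<le> n \<Longrightarrow> 1 \<le> norm u \<Longrightarrow> norm u \<le> \<alpha> \<Longrightarrow> rho \<zeta> \<le> norm v \<Longrightarrow>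
          norm (poly (legendre_primitive n) (joukowski u)) < norm (poly (legendre_primitive n) (joukowski v))"
        using legendre_primitive_separation[of \<alpha> "rho \<zeta>"] \<alpha> r(1)
        unfolding eventually_sequentially by (meson le_less_trans less_imp_le)
      ultimately obtain n u where u: "N \<le> n" "1 \<le> norm u" "?f (joukowski u) < \<alpha> + 1 / \<alpha>"
        "poly (legendre_primitive n) (joukowski u) = poly (legendre_primitive n) \<zeta>"
        using zero[of "{z. ?f z < \<alpha> + 1 / \<alpha>}" N] by blast
      then have "norm u \<le> \<alpha>"
        using \<alpha> r add_inverse_less_iff[of "norm u" \<alpha>] by (simp add: f)
      then show False using N[of n u q] u q by simp
    next
      case 2
      \<comment> \<open>Near \<open>w\<close> the primitives are eventually too large to take their value at \<open>\<zeta>\<close>.\<close>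
      then obtain \<beta> where \<beta>: "rho \<zeta> < \<beta>" "\<beta> < norm r" using dense by blast
      have "open {z. \<beta> + 1 / \<beta> < ?f z}" by (intro open_Collect_less continuous_intros)
      moreover have "w \<in> {z. \<beta> + 1 / \<beta> < ?f z}"
        using \<beta> r q add_inverse_less_iff[of \<beta> "norm r"] by (simp add: f)
      moreover obtain N where N: "\<And>n u v. N \<le> n \<Longrightarrow> 1 \<le> norm u \<Longrightarrow> norm u \<le> rho \<zeta> \<Longrightarrow> \<beta> \<le> norm v \<Longrightarrow>
          norm (poly (legendre_primitive n) (joukowski u)) < norm (poly (legendre_primitive n) (joukowski v))"
        using legendre_primitive_separation[of "rho \<zeta>" \<beta>] \<beta> q(2)
        unfolding eventually_sequentially by (meson less_imp_le)
      ultimately obtain n u where u: "N \<le> n" "1 \<le> norm u" "\<beta> + 1 / \<beta> < ?f (joukowski u)"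
        "poly (legendre_primitive n) (joukowski u) = poly (legendre_primitive n) \<zeta>"
        using zero[of "{z. \<beta> + 1 / \<beta> < ?f z}" N] by blast
      then have "\<beta> \<le> norm u"
        using \<beta> q add_inverse_less_iff[of \<beta> "norm u"] by (simp add: f)
      then show False using N[of n q u] u q by simp
    qed
  qed
  then show "w \<in> ellipse \<zeta>" using joukowski_on_ellipse[of r \<zeta>] r by simp
qed

end
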